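(* Let $\mathcal{X},\mathcal{U},\mathcal{W}$ be sets with $\mathcal{U},\mathcal{W}$ nonempty, let $f:\mathcal{X}\times\mathcal{U}\times\mathcal{W}\to\mathcal{X}$ be a map, let $N\ge 0$ be an integer, and let $X=(X_0,\dots,X_N)$ be a sequence of subsets of $\mathcal{X}$ (the target tube). Let $\mathcal{G}$ be a group and let $h=(h_\alpha)_{\alpha\in\mathcal{G}}$, $h_\alpha=(\phi_\alpha,\chi_\alpha,\psi_\alpha)$, be a transformation group on $\mathcal{X}\times\mathcal{U}\times\mathcal{W}$ such that the backward reachability problem $(f,X)$ is invariant under $h$. Let $\bar X_0,\dots,\bar X_N$ be the effective target sets of $(f,X)$. Then for every $k\in\{0,\dots,N\}$, if $x_k\in\bar X_k$, then $\phi_\alpha(x_k)\in\bar X_k$ for all $\alpha\in\mathcal{G}$.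
   Context: The system is $x_{k+1}=f(x_k,u_k,w_k)$ with state $x_k\in\mathcal{X}$, control $u_k\in\mathcal{U}$ and disturbance $w_k\in\mathcal{W}$. Effective target sets: $\bar X_k$ is the set of states $x_k\in\mathcal{X}$ for which there is a control policy $(\mu_k,\dots,\mu_{N-1})$, with each $\mu_t:\mathcal{X}\to\mathcal{U}$, such that for every disturbance sequence $(w_k,\dots,w_{N-1})\in\mathcal{W}^{N-k}$ the trajectory $x_{t+1}=f(x_t,\mu_t(x_t),w_t)$, $t=k,\dots,N-1$, started at $x_k$ satisfies $x_t\in X_t$ for all $t=k,\dots,N$. Equivalently, $\bar X_k=\{x\in\mathcal{X}: J_k(x)=0\}$, where $g_k(x)=0$ if $x\in X_k$ and $g_k(x)=1$ if $x\notin X_k$, and $J_N(x)=g_N(x)$, $J_k(x)=\min_{u\in\mathcal{U}}\max_{w\in\mathcal{W}}\,[g_k(x)+J_{k+1}(f(x,u,w))]$ for $k=N-1,\dots,0$. (These functions take values in $\{0,1,\dots,N+1\}$, so the minima and maxima are attained.) Transformation group: a family of tuples $h_\alpha=(\phi_\alpha,\chi_\alpha,\psi_\alpha)$ indexed by $\alpha\in\mathcal{G}$, where $\phi_\alpha:\mathcal{X}\to\mathcal{X}$, $\chi_\alpha:\mathcal{U}\to\mathcal{U}$, $\psi_\alpha:\mathcal{W}\to\mathcal{W}$ are bijections, such that $\phi_e,\chi_e,\psi_e$ are identity maps for the identity $e$ of $\mathcal{G}$, and $\phi_{a*b}=\phi_a\circ\phi_b$, $\chi_{a*b}=\chi_a\circ\chi_b$,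 $\psi_{a*b}=\psi_a\circ\psi_b$ for all $a,b\in\mathcal{G}$, where $*$ is the group operation. Invariance: $(f,X)$ is invariant under $h$ if for all $\alpha\in\mathcal{G}$: (i) $\phi_\alpha(x)\in X_k$ for all $x\in X_k$ and $k=0,\dots,N$; and (ii) $\phi_\alpha^{-1}\big(f(\phi_\alpha(x),\chi_\alpha(u),\psi_\alpha(w))\big)=f(x,u,w)$ for all $x\in\mathcal{X}$, $u\in\mathcal{U}$, $w\in\mathcal{W}$. *)

theory Defs
  imports "HOL-Algebra.Group"
begin

text \<open>
  The sets of states, controls and disturbances are carrier sets \<open>S\<close>, \<open>U\<close>, \<open>W\<close>, so that \<open>S\<close> may be
  empty. Functions are only constrained on these carriers, and time-indexed families
  (tube, policy, disturbances) only on the relevant time indices.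
\<close>

text \<open>
  \<open>trajectory f \<mu> w k x j\<close> is the state at time \<open>k + j\<close> when starting at \<open>x\<close> at time \<open>k\<close>.
\<close>

primrec trajectory ::
  "('x \<Rightarrow> 'u \<Rightarrow> 'w \<Rightarrow> 'x) \<Rightarrow> (nat \<Rightarrow> 'x \<Rightarrow> 'u) \<Rightarrow> (nat \<Rightarrow> 'w) \<Rightarrow> nat \<Rightarrow> 'x \<Rightarrow> nat \<Rightarrow> 'x"
where
  "trajectory f \<mu> w k x 0 = x"
| "trajectory f \<mu> w k x (Suc j) =
     (let y = trajectory f \<mu> w k x j in f y (\<mu> (k + j) y) (w (k + j)))"

definition effective_target_set ::
  "'x set \<Rightarrow> 'u set \<Rightarrow> 'w set \<Rightarrow> ('x \<Rightarrow> 'u \<Rightarrow> 'w \<Rightarrow> 'x) \<Rightarrow> nat \<Rightarrow> (nat \<Rightarrow> 'x set) \<Rightarrow> nat \<Rightarrow> 'x set"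
where
  "effective_target_set S U W f N X k =
     {x \<in> S. \<exists>\<mu>. (\<forall>t\<in>{k..<N}. \<mu> t \<in> S \<rightarrow> U) \<and>
        (\<forall>w. (\<forall>t\<in>{k..<N}. w t \<in> W) \<longrightarrow>
           (\<forall>t\<in>{k..N}. trajectory f \<mu> w k x (t - k) \<in> X t))}"

definition transformation_group ::
  "('g, 'm) monoid_scheme \<Rightarrow> 'x set \<Rightarrow> 'u set \<Rightarrow> 'w set \<Rightarrow>
     ('g \<Rightarrow> 'x \<Rightarrow> 'x) \<Rightarrow> ('g \<Rightarrow> 'u \<Rightarrow> 'u) \<Rightarrow> ('g \<Rightarrow> 'w \<Rightarrow> 'w) \<Rightarrow> bool"
where
  "transformation_group G S U W \<phi> \<chi> \<psi> \<longleftrightarrow>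
     (\<forall>a\<in>carrier G. bij_betw (\<phi> a) S S \<and> bij_betw (\<chi> a) U U \<and> bij_betw (\<psi> a) W W) \<and>
     (\<forall>x\<in>S. \<phi> \<one>\<^bsub>G\<^esub> x = x) \<and> (\<forall>u\<in>U. \<chi> \<one>\<^bsub>G\<^esub> u = u) \<and> (\<forall>w\<in>W. \<psi> \<one>\<^bsub>G\<^esub> w = w) \<and>
     (\<forall>a\<in>carrier G. \<forall>b\<in>carrier G.
        (\<forall>x\<in>S. \<phi> (a \<otimes>\<^bsub>G\<^esub> b) x = \<phi> a (\<phi> b x)) \<and>
        (\<forall>u\<in>U. \<chi> (a \<otimes>\<^bsub>G\<^esub> b) u = \<chi> a (\<chi> b u)) \<and>
        (\<forall>w\<in>W. \<psi> (a \<otimes>\<^bsub>G\<^esub> b) w = \<psi> a (\<psi> b w)))"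

definition invariant_under ::
  "('g, 'm) monoid_scheme \<Rightarrow> 'x set \<Rightarrow> 'u set \<Rightarrow> 'w set \<Rightarrow>
     ('g \<Rightarrow> 'x \<Rightarrow> 'x) \<Rightarrow> ('g \<Rightarrow> 'u \<Rightarrow> 'u) \<Rightarrow> ('g \<Rightarrow> 'w \<Rightarrow> 'w) \<Rightarrow>
     ('x \<Rightarrow> 'u \<Rightarrow> 'w \<Rightarrow> 'x) \<Rightarrow> nat \<Rightarrow> (nat \<Rightarrow> 'x set) \<Rightarrow> bool"
where
  "invariant_under G S U W \<phi> \<chi> \<psi> f N X \<longleftrightarrow>
     (\<forall>a\<in>carrier G.
        (\<forall>k\<in>{0..N}. \<forall>x\<in>X k. \<phi> a x \<in> X k) \<and>
        (\<forall>x\<in>S. \<forall>u\<in>U. \<forall>w\<in>W.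
           inv_into S (\<phi> a) (f (\<phi> a x) (\<chi> a u) (\<psi> a w)) = f x u w))"

end

theory Submission
  imports Defs
begin

text \<open>
  If a policy \<open>\<mu>\<close> keeps the system in the tube from \<open>x\<close>, then the conjugated policy
  \<open>\<chi> \<circ> \<mu> t \<circ> \<phi>\<inverse>\<close> does so from \<open>\<phi> x\<close>: its trajectory under \<open>w\<close> is the \<open>\<phi>\<close>-image of the trajectory
  of \<open>\<mu>\<close> under \<open>\<psi>\<inverse> \<circ> w\<close>.
\<close>

text \<open>Equivariance, and the cancellation of \<open>inv_into S p\<close> against
  \<open>p\<close>, are available only on \<open>S\<close>, so the conjugation argument needs every
  visited state to lie there.\<close>

lemma trajectory_in_carrier:
  assumes f: "f \<in> S \<rightarrow> U \<rightarrow> W \<rightarrow> S" and x: "x \<in> S"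
    and \<mu>: "\<And>t. t \<in> {k..<k + j} \<Longrightarrow> \<mu> t \<in> S \<rightarrow> U"
    and w: "\<And>t. t \<in> {k..<k + j} \<Longrightarrow> w t \<in> W"
  shows "trajectory f \<mu> w k x j \<in> S"
  using \<mu> w
proof (induction j)
  case (Suc j)
  let ?y = "trajectory f \<mu> w k x j"
  have "?y \<in> S" using Suc by simp
  moreover have "\<mu> (k + j) ?y \<in> U" using calculation Suc.prems(1)[of "k + j"] by auto
  moreover have "w (k + j) \<in> W" using Suc.prems(2)[of "k + j"] by simp
  ultimately show ?case using f by (auto simp: Let_def Pi_iff)
qed (simp add: x)

text \<open>Induction on \<open>j\<close>, pushing \<open>p\<close> through one step of
  \<open>f\<close> at a time. The link between \<open>w'\<close> and \<open>w\<close> is an equation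
  on the time window rather than a composition, because a given disturbance lies in \<open>W\<close>
  only before the horizon and can be recovered from its pullback only there.\<close>

lemma trajectory_conjugate:
  assumes f: "f \<in> S \<rightarrow> U \<rightarrow> W \<rightarrow> S" and x: "x \<in> S"
    and p: "inj_on p S"
    and equivariant: "\<And>x u w. x \<in> S \<Longrightarrow> u \<in> U \<Longrightarrow> w \<in> W \<Longrightarrow> f (p x) (c u) (q w) = p (f x u w)"
    and \<mu>: "\<And>t. t \<in> {k..<k + j} \<Longrightarrow> \<mu> t \<in> S \<rightarrow> U"
    and w: "\<And>t. t \<in> {k..<k + j} \<Longrightarrow> w t \<in> W"
    and w': "\<And>t. t \<in> {k..<k + j} \<Longrightarrow> w' t = q (w t)"
  shows "trajectory f (\<lambda>t y. c (\<mu> t (inv_into S p y))) w' k (p x) j = p (trajectory f \<mu> w k x j)"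
  using \<mu> w w'
proof (induction j)
  case (Suc j)
  let ?y = "trajectory f \<mu> w k x j"
  have y: "?y \<in> S" using trajectory_in_carrier[OF f x, of k j \<mu> w] Suc.prems by simp
  moreover have "\<mu> (k + j) ?y \<in> U" using y Suc.prems(1)[of "k + j"] by auto
  moreover have "w (k + j) \<in> W" using Suc.prems(2)[of "k + j"] by simp
  moreover have "w' (k + j) = q (w (k + j))" using Suc.prems(3)[of "k + j"] by simp
  \<comment> \<open>By the induction hypothesis the conjugated system is at \<open>p ?y\<close>.
    Injectivity turns \<open>inv_into S p (p ?y)\<close> into \<open>?y\<close>, so the control
    applied is \<open>c (\<mu> (k + j) ?y)\<close> and equivariance gives the next state.\<close>
  ultimately show ?case
    using Suc equivariant p by (simp add: Let_def)
qed simp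

text \<open>The roles of \<open>c\<close> and \<open>q\<close> differ: controls are chosen, so they
  are only pushed forward into \<open>U\<close>, whereas every disturbance must be answered, so it
  is pulled back through the surjection \<open>q\<close>.\<close>

lemma image_effective_target_set:
  assumes f: "f \<in> S \<rightarrow> U \<rightarrow> W \<rightarrow> S"
    and p: "bij_betw p S S" and c: "c \<in> U \<rightarrow> U" and q: "bij_betw q W W"
    and tube: "\<And>t x. t \<in> {k..N} \<Longrightarrow> x \<in> X t \<Longrightarrow> p x \<in> X t"
    and equivariant: "\<And>x u w. x \<in> S \<Longrightarrow> u \<in> U \<Longrightarrow> w \<in> W \<Longrightarrow> f (p x) (c u) (q w) = p (f x u w)"
    and x: "x \<in> effective_target_set S U W f N X k"
  shows "p x \<in> effective_target_set S U W f N X k"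
proof -
  obtain \<mu> where xS: "x \<in> S" and \<mu>: "\<And>t. t \<in> {k..<N} \<Longrightarrow> \<mu> t \<in> S \<rightarrow> U"
    and reach: "\<And>w t. \<lbrakk>\<And>s. s \<in> {k..<N} \<Longrightarrow> w s \<in> W; t \<in> {k..N}\<rbrakk>
      \<Longrightarrow> trajectory f \<mu> w k x (t - k) \<in> X t"
    using x unfolding effective_target_set_def by blast
  let ?\<mu> = "\<lambda>t y. c (\<mu> t (inv_into S p y))"
  have "trajectory f ?\<mu> w k (p x) (t - k) \<in> X t"
    if w: "\<forall>s\<in>{k..<N}. w s \<in> W" and t: "t \<in> {k..N}" for w t
  proof -
    let ?w = "\<lambda>s. inv_into W q (w s)"
    have w': "?w s \<in> W" "w s = q (?w s)" if "s \<in> {k..<N}" for s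
      using w that q bij_betw_inv_into_right[OF q, of "w s"]
      by (auto simp: bij_betw_def intro: inv_into_into)
    \<comment> \<open>The window \<open>{k..<k + (t - k)}\<close> is \<open>{k..<t}\<close>, which
      lies inside \<open>{k..<N}\<close>.\<close>
    have "trajectory f ?\<mu> w k (p x) (t - k) = p (trajectory f \<mu> ?w k x (t - k))"
      by (rule trajectory_conjugate[OF f xS bij_betw_imp_inj_on[OF p] equivariant])
        (use t \<mu> w' in auto)
    then show ?thesis using tube[OF t reach[of ?w, OF _ t]] w' by simp
  qed
  \<comment> \<open>Since \<open>p\<close> is onto \<open>S\<close>, \<open>inv_into S p\<close>
    maps \<open>S\<close> into \<open>S\<close>, where \<open>\<mu> t\<close> takes values in
    \<open>U\<close>.\<close>
  moreover have "?\<mu> t \<in> S \<rightarrow> U" if "t \<in> {k..<N}" for t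
    using \<mu>[OF that] c p by (auto simp: bij_betw_def Pi_iff inv_into_into)
  ultimately show ?thesis
    using bij_betwE[OF p] xS unfolding effective_target_set_def
    by (intro CollectI conjI exI[of _ ?\<mu>] ballI allI impI) auto
qed

theorem proposition1:
  fixes S :: "'x set" and U :: "'u set" and W :: "'w set"
    and f :: "'x \<Rightarrow> 'u \<Rightarrow> 'w \<Rightarrow> 'x"
    and N :: nat and X :: "nat \<Rightarrow> 'x set"
    and G :: "('g, 'm) monoid_scheme"
    and \<phi> :: "'g \<Rightarrow> 'x \<Rightarrow> 'x" and \<chi> :: "'g \<Rightarrow> 'u \<Rightarrow> 'u" and \<psi> :: "'g \<Rightarrow> 'w \<Rightarrow> 'w"
  assumes "U \<noteq> {}" and "W \<noteq> {}"
    and "f \<in> S \<rightarrow> U \<rightarrow> W \<rightarrow> S"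
    and "\<forall>k\<in>{0..N}. X k \<subseteq> S"
    and "group G"
    and "transformation_group G S U W \<phi> \<chi> \<psi>"
    and "invariant_under G S U W \<phi> \<chi> \<psi> f N X"
  shows "\<forall>k\<in>{0..N}. \<forall>x\<in>effective_target_set S U W f N X k.
           \<forall>\<alpha>\<in>carrier G. \<phi> \<alpha> x \<in> effective_target_set S U W f N X k"
proof (intro ballI)
  fix k x \<alpha>
  assume k: "k \<in> {0..N}" and x: "x \<in> effective_target_set S U W f N X k" and \<alpha>: "\<alpha> \<in> carrier G"
  have bij: "bij_betw (\<phi> \<alpha>) S S" "bij_betw (\<chi> \<alpha>) U U" "bij_betw (\<psi> \<alpha>) W W"
    using assms(6) \<alpha> unfolding transformation_group_def by auto
  show "\<phi> \<alpha> x \<in> effective_target_set S U W f N X k"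
  proof (rule image_effective_target_set[OF assms(3) bij(1) _ bij(3) _ _ x])
    show "\<chi> \<alpha> \<in> U \<rightarrow> U" using bij_betwE[OF bij(2)] by blast
    show "\<phi> \<alpha> y \<in> X t" if "t \<in> {k..N}" "y \<in> X t" for t y
      using assms(7) \<alpha> that unfolding invariant_under_def by auto
    show "f (\<phi> \<alpha> y) (\<chi> \<alpha> u) (\<psi> \<alpha> w) = \<phi> \<alpha> (f y u w)"
      if "y \<in> S" "u \<in> U" "w \<in> W" for y u w
    \<comment> \<open>Invariance has the inverse of \<open>\<phi> \<alpha>\<close> on the left.
      Applying \<open>\<phi> \<alpha>\<close> to both sides cancels it only once \<open>?z\<close>
      is known to lie in \<open>S\<close>, the image of \<open>\<phi> \<alpha>\<close>; elsewhere
      \<open>inv_into\<close> is unspecified.\<close>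
    proof -
      let ?z = "f (\<phi> \<alpha> y) (\<chi> \<alpha> u) (\<psi> \<alpha> w)"
      have "\<phi> \<alpha> y \<in> S" "\<chi> \<alpha> u \<in> U" "\<psi> \<alpha> w \<in> W"
        using that bij[THEN bij_betwE] by auto
      then have "?z \<in> S" using assms(3) by (auto simp: Pi_iff)
      then have "\<phi> \<alpha> (inv_into S (\<phi> \<alpha>) ?z) = ?z"
        using bij_betw_inv_into_right[OF bij(1)] by blast
      moreover have "inv_into S (\<phi> \<alpha>) ?z = f y u w"
        using assms(7) \<alpha> that unfolding invariant_under_def by blast
      ultimately show ?thesis by simp
    qed
  qed
qed

end
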